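(* Let $\ell_1,\ell_2,m$ and $n$ be positive integers with $\ell_1,\ell_2,m\geq 3$ odd, let $t$ be a positive integer, and let $S$ be a subset of $\mathbb{Z}_n$. If $\mathrm{HWP}(C_m[n,S];\ell_1,\ell_2;\alpha,\beta)$ has a solution, then there is a solution to $\mathrm{HWP}(C_{2^tm}[n,S];2^t\ell_1,2^t\ell_2;\alpha,\beta)$.
   Context: All graphs are finite and simple. For integers $M\geq 3$, $n\geq 1$ and $S\subseteq\mathbb{Z}_n$, $C_M[n,S]$ is the graph with vertex set $\mathbb{Z}_M\times\mathbb{Z}_n$ whose edges are exactly the pairs $\{(x,i),(x+1,i+d)\}$ with $x\in\mathbb{Z}_M$, $i\in\mathbb{Z}_n$, $d\in S$. A $C_\ell$-factor of a graph $G$ is a spanning subgraph of $G$ that is a vertex-disjoint union of cycles of length $\ell$. For nonnegative integers $\alpha,\beta$, a solution to $\mathrm{HWP}(G;a,b;\alpha,\beta)$ is a partition of the edge set of $G$ into the edge sets of $\alpha$ $C_a$-factors and $\beta$ $C_b$-factors of $G$. *)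

theory Defs
  imports Main "HOL-Library.Disjoint_Sets"
begin

datatype 'v graph = Graph (verts: "'v set") (edges: "'v set set")

definition simple_graph :: "'v graph \<Rightarrow> bool" where
  "simple_graph G \<longleftrightarrow> finite (verts G) \<and> (\<forall>e\<in>edges G. e \<subseteq> verts G \<and> card e = 2)"

definition spanning_subgraph :: "'v graph \<Rightarrow> 'v graph \<Rightarrow> bool" where
  "spanning_subgraph H G \<longleftrightarrow> simple_graph H \<and> verts H = verts G \<and> edges H \<subseteq> edges G"

definition cycle_graph :: "'v list \<Rightarrow> 'v graph" where
  "cycle_graph vs =
     Graph (set vs) {{vs ! i, vs ! (Suc i mod length vs)} |i. i < length vs}"

definition is_cycle :: "nat \<Rightarrow> 'v graph \<Rightarrow> bool" where
  "is_cycle l C \<longleftrightarrow> l \<ge> 3 \<and> (\<exists>vs. distinct vs \<and> length vs = l \<and> C = cycle_graph vs)"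

definition cycle_factor :: "nat \<Rightarrow> 'v graph \<Rightarrow> 'v graph \<Rightarrow> bool" where
  "cycle_factor l G H \<longleftrightarrow> spanning_subgraph H G \<and>
     (\<exists>\<C>. (\<forall>C\<in>\<C>. is_cycle l C) \<and> disjoint_family_on verts \<C> \<and>
          H = Graph (\<Union>C\<in>\<C>. verts C) (\<Union>C\<in>\<C>. edges C))"

text \<open>
  A solution is given by the edge sets of its factors: \<open>P\<close> collects those of the \<open>\<alpha>\<close>
  \<open>C\<^sub>a\<close>-factors and \<open>Q\<close> those of the \<open>\<beta>\<close> \<open>C\<^sub>b\<close>-factors.  Disjointness of \<open>P\<close> and \<open>Q\<close> is
  required explicitly, so that for \<open>a = b\<close> no factor is counted twice.
\<close>

definition HWP_solution ::
  "'v graph \<Rightarrow> nat \<Rightarrow> nat \<Rightarrow> nat \<Rightarrow> nat \<Rightarrow> 'v set set set \<Rightarrow> 'v set set set \<Rightarrow> bool" where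
  "HWP_solution G a b \<alpha> \<beta> P Q \<longleftrightarrow>
     finite P \<and> card P = \<alpha> \<and> (\<forall>F\<in>P. \<exists>H. cycle_factor a G H \<and> F = edges H) \<and>
     finite Q \<and> card Q = \<beta> \<and> (\<forall>F\<in>Q. \<exists>H. cycle_factor b G H \<and> F = edges H) \<and>
     P \<inter> Q = {} \<and> partition_on (edges G) (P \<union> Q)"

definition HWP :: "'v graph \<Rightarrow> nat \<Rightarrow> nat \<Rightarrow> nat \<Rightarrow> nat \<Rightarrow> bool" where
  "HWP G a b \<alpha> \<beta> \<longleftrightarrow> (\<exists>P Q. HWP_solution G a b \<alpha> \<beta> P Q)"

text \<open>
  The graph \<open>C\<^sub>M[n,S]\<close>; the elements of \<open>\<int>\<^sub>k\<close> are represented by their residues \<open>0, \<dots>, k - 1\<close>,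
  and \<open>S\<close> is meant to be a subset of \<open>{0..<n}\<close>.
\<close>

definition C_blowup :: "nat \<Rightarrow> nat \<Rightarrow> nat set \<Rightarrow> (nat \<times> nat) graph" where
  "C_blowup M n S =
     Graph ({0..<M} \<times> {0..<n})
       {{(x, i), ((x + 1) mod M, (i + d) mod n)} |x i d. x < M \<and> i < n \<and> d \<in> S}"

lemma simple_graph_C_blowup:
  assumes "M \<ge> 3" "n \<ge> 1"
  shows "simple_graph (C_blowup M n S)"
proof -
  have "x \<noteq> Suc x mod M" if "x < M" for x
    using that assms(1) by (cases "Suc x = M") auto
  then show ?thesis
    using assms by (auto simp: simple_graph_def C_blowup_def card_insert_if)
qed

end

theory Submission
  imports Defs "HOL-Number_Theory.Cong"
begin

text \<open>
  Reducing the first coordinate modulo \<open>m\<close> is a covering map from \<open>C\<^bsub>2\<^sup>t m\<^esub>[n,S]\<close> to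
  \<open>C\<^sub>m[n,S]\<close>.  Every edge changes the first coordinate by \<open>1\<close> or \<open>-1\<close>, so one turn around a cycle
  of odd length \<open>\<ell>\<close> in \<open>C\<^sub>m[n,S]\<close> changes it by a sum \<open>D\<close> of \<open>\<ell>\<close> signs, computed in the integers.
  This \<open>D\<close> is odd, and it is a multiple of \<open>m\<close> because the cycle closes; hence the winding number
  \<open>D / m\<close> is odd and so generates \<open>\<int>\<close> modulo \<open>2\<^sup>t\<close>.  Lifting the cycle to the covering graph, one
  returns to the starting vertex only after \<open>2\<^sup>t\<close> turns and meets every vertex above the cycle on the
  way.  So the part of the covering graph above a cycle of odd length \<open>\<ell>\<close> is a single cycle of length
  \<open>2\<^sup>t \<ell>\<close> (lemma \<open>is_cycle_lift_graph\<close>).  Preimages respect disjointness and unions, so preimages of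
  factors are factors (lemma \<open>cycle_factor_lift_graph\<close>), and the preimages of the edge sets in a
  solution partition the edges of the covering graph.
\<close>

section \<open>The covering map\<close>

definition proj :: "nat \<Rightarrow> nat \<times> nat \<Rightarrow> nat \<times> nat" where
  "proj m u = (fst u mod m, snd u)"

definition lift_edges :: "nat \<Rightarrow> (nat \<times> nat) graph \<Rightarrow> (nat \<times> nat) set set \<Rightarrow> (nat \<times> nat) set set" where
  "lift_edges m G F = {e \<in> edges G. proj m ` e \<in> F}"

definition lift_graph :: "nat \<Rightarrow> (nat \<times> nat) graph \<Rightarrow> (nat \<times> nat) graph \<Rightarrow> (nat \<times> nat) graph" where
  "lift_graph m G H = Graph {u \<in> verts G. proj m u \<in> verts H} (lift_edges m G (edges H))"

text \<open>
  The possible changes \<open>s\<close> of the first coordinate along an edge joining the second coordinates \<open>i\<close>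
  and \<open>j\<close>.  The relation does not mention the length of the underlying cycle, which is why
  \<open>C\<^sub>m[n,S]\<close> and its covering graph can share it.
\<close>

definition step :: "nat \<Rightarrow> nat set \<Rightarrow> int \<Rightarrow> nat \<Rightarrow> nat \<Rightarrow> bool" where
  "step n S s i j \<longleftrightarrow>
     s = 1 \<and> (\<exists>d\<in>S. j = (i + d) mod n) \<or> s = -1 \<and> (\<exists>d\<in>S. i = (j + d) mod n)"

lemma verts_C_blowup: "verts (C_blowup M n S) = {0..<M} \<times> {0..<n}"
  by (simp add: C_blowup_def)

lemma successor_residue_iff:
  fixes x y M :: nat
  assumes "x < M" "y < M"
  shows "int y = (int x + 1) mod int M \<longleftrightarrow> y = (x + 1) mod M"
    and "int y = (int x - 1) mod int M \<longleftrightarrow> x = (y + 1) mod M"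
proof -
  show "int y = (int x + 1) mod int M \<longleftrightarrow> y = (x + 1) mod M"
    by (metis of_nat_1 of_nat_add of_nat_eq_iff of_nat_mod)
  have "int x = (int y + 1) mod int M \<longleftrightarrow> int y = (int x - 1) mod int M"
  proof
    assume "int x = (int y + 1) mod int M"
    then have "(int x - 1) mod int M = int y mod int M"
      by (metis add_diff_cancel_right' mod_diff_left_eq)
    then show "int y = (int x - 1) mod int M" using assms by simp
  next
    assume "int y = (int x - 1) mod int M"
    then have "(int y + 1) mod int M = int x mod int M"
      by (metis diff_add_cancel mod_add_left_eq)
    then show "int x = (int y + 1) mod int M" using assms by simp
  qed
  moreover have "int x = (int y + 1) mod int M \<longleftrightarrow> x = (y + 1) mod M"
    by (metis of_nat_1 of_nat_add of_nat_eq_iff of_nat_mod)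
  ultimately show "int y = (int x - 1) mod int M \<longleftrightarrow> x = (y + 1) mod M" by blast
qed

lemma edge_C_blowup_iff_step:
  assumes u: "u \<in> verts (C_blowup M n S)" and v: "v \<in> verts (C_blowup M n S)"
  shows "{u, v} \<in> edges (C_blowup M n S) \<longleftrightarrow>
    (\<exists>s. step n S s (snd u) (snd v) \<and> int (fst v) = (int (fst u) + s) mod int M)"
proof -
  obtain x i y j where uv: "u = (x, i)" "v = (y, j)" by (meson surj_pair)
  have b: "x < M" "i < n" "y < M" "j < n" using u v uv by (auto simp: verts_C_blowup)
  have "{u, v} \<in> edges (C_blowup M n S) \<longleftrightarrow>
     (\<exists>d\<in>S. y = (x + 1) mod M \<and> j = (i + d) mod n) \<or> (\<exists>d\<in>S. x = (y + 1) mod M \<and> i = (j + d) mod n)"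
    using b unfolding uv C_blowup_def by (auto simp: doubleton_eq_iff)
  then show ?thesis
    using successor_residue_iff[OF b(1,3)] unfolding uv step_def by auto
qed

lemma edge_C_blowup_cases:
  assumes "e \<in> edges (C_blowup M n S)"
  obtains u v where "e = {u, v}" "u \<in> verts (C_blowup M n S)" "v \<in> verts (C_blowup M n S)"
proof -
  obtain x i d where e: "e = {(x, i), ((x + 1) mod M, (i + d) mod n)}" "x < M" "i < n"
    using assms by (auto simp: C_blowup_def)
  then show ?thesis by (intro that[OF e(1)]) (auto simp: verts_C_blowup)
qed

lemma proj_verts:
  "m > 0 \<Longrightarrow> u \<in> verts (C_blowup M n S) \<Longrightarrow> proj m u \<in> verts (C_blowup m n S)"
  by (auto simp: verts_C_blowup proj_def)

lemma proj_edge: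
  assumes "m > 0" "m dvd M" and e: "e \<in> edges (C_blowup M n S)"
  shows "proj m ` e \<in> edges (C_blowup m n S)"
proof -
  obtain x i d where e: "e = {(x, i), ((x + 1) mod M, (i + d) mod n)}" "i < n" "d \<in> S"
    using e by (auto simp: C_blowup_def)
  have "proj m ` e = {(x mod m, i), ((x mod m + 1) mod m, (i + d) mod n)}"
    using assms(2) by (simp add: e(1) proj_def mod_mod_cancel mod_Suc_eq)
  moreover have "x mod m < m" using assms by simp
  ultimately show ?thesis using e unfolding C_blowup_def graph.sel by blast
qed

lemma edge_has_lift:
  assumes "M > 0" "m dvd M" and e: "e \<in> edges (C_blowup m n S)"
  obtains e' where "e' \<in> edges (C_blowup M n S)" "proj m ` e' = e"
proof -
  obtain x i d where e: "e = {(x, i), ((x + 1) mod m, (i + d) mod n)}" "x < m" "i < n" "d \<in> S"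
    using e by (auto simp: C_blowup_def)
  have "m \<le> M" using assms by (simp add: dvd_imp_le)
  then have "x < M" using e by simp
  then have "{(x, i), ((x + 1) mod M, (i + d) mod n)} \<in> edges (C_blowup M n S)"
    using e unfolding C_blowup_def graph.sel by blast
  moreover have "proj m ` {(x, i), ((x + 1) mod M, (i + d) mod n)} = e"
    using assms(2) e by (simp add: proj_def mod_mod_cancel)
  ultimately show ?thesis by (rule that)
qed

text \<open>
  The covering map is injective on neighbourhoods: two neighbours of a vertex differ in their first
  coordinate by \<open>0\<close> or \<open>\<plusminus>2\<close>, and \<open>2\<close> does not vanish modulo \<open>m\<close> since \<open>m \<ge> 3\<close>.
\<close>

lemma unique_edge_lift:
  assumes m: "m \<ge> 3" "m dvd M"
    and V: "u \<in> verts (C_blowup M n S)" "v \<in> verts (C_blowup M n S)" "w \<in> verts (C_blowup M n S)"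
    and E: "{u, v} \<in> edges (C_blowup M n S)" "{u, w} \<in> edges (C_blowup M n S)"
    and p: "proj m v = proj m w"
  shows "v = w"
proof -
  obtain s where s: "s = 1 \<or> s = -1" "int (fst v) = (int (fst u) + s) mod int M"
    using E(1) edge_C_blowup_iff_step[OF V(1,2)] by (auto simp: step_def)
  obtain r where r: "r = 1 \<or> r = -1" "int (fst w) = (int (fst u) + r) mod int M"
    using E(2) edge_C_blowup_iff_step[OF V(1,3)] by (auto simp: step_def)
  have "int (fst v) mod int m = int (fst w) mod int m"
    using p by (metis proj_def fst_conv of_nat_mod)
  then have "(int (fst u) + s) mod int m = (int (fst u) + r) mod int m"
    using s r m by (simp add: mod_mod_cancel)
  then have "int m dvd s - r"
    by (simp add: mod_eq_dvd_iff)
  moreover have "\<bar>s - r\<bar> < int m" using s r m by auto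
  ultimately have "s = r" using zdvd_imp_le[of "int m" "\<bar>s - r\<bar>"] by fastforce
  then have "fst v = fst w" using s r by simp
  then show ?thesis using p by (simp add: proj_def prod_eq_iff)
qed

section \<open>The preimage of an odd cycle\<close>

text \<open>
  With \<open>s\<close> the steps along a closed walk of length \<open>l\<close>, each of \<open>q\<close> extra turns contributes the total
  displacement of one turn, wherever on the walk it starts.
\<close>

lemma sum_periodic_shift:
  fixes s :: "nat \<Rightarrow> int"
  shows "(\<Sum>k<j + q * l. s (k mod l)) = (\<Sum>k<j. s (k mod l)) + int q * (\<Sum>k<l. s k)"
proof (induction q)
  case (Suc q)
  have one: "(\<Sum>k<j + l. s (k mod l)) = (\<Sum>k<j. s (k mod l)) + (\<Sum>k<l. s k)" for j
  proof (induction j)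
    case (Suc j)
    then show ?case by simp
  qed simp
  have "j + Suc q * l = (j + q * l) + l" by simp
  then show ?case using one[of "j + q * l"] Suc by (simp add: algebra_simps)
qed simp

lemma odd_sum_of_oddly_many_odds:
  fixes s :: "nat \<Rightarrow> int"
  assumes "odd l" "\<And>k. k < l \<Longrightarrow> odd (s k)"
  shows "odd (\<Sum>k<l. s k)"
proof -
  have "{k \<in> {..<l}. odd (s k)} = {..<l}" using assms(2) by auto
  then show ?thesis using assms(1) by (simp add: even_sum_iff)
qed

text \<open>
  Walking along the lift of the cycle passes through a given fibre once per turn, and each turn
  moves within the fibre by \<open>m\<close> times the winding number.  As that number is odd, the walk runs
  through all \<open>2\<^sup>t\<close> vertices of the fibre before it closes; since lifts of edges are unique, no edges
  above the cycle remain besides those traversed.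
\<close>

lemma is_cycle_lift_graph:
  fixes l m n t :: nat and S :: "nat set"
  defines "G' \<equiv> C_blowup (2 ^ t * m) n S"
  assumes l: "odd l" and m: "m \<ge> 3" and C: "is_cycle l C"
    and CV: "verts C \<subseteq> verts (C_blowup m n S)" and CE: "edges C \<subseteq> edges (C_blowup m n S)"
  shows "is_cycle (2 ^ t * l) (lift_graph m G' C)"
proof -
  define M where "M = 2 ^ t * m"
  define L where "L = 2 ^ t * l"
  have G': "G' = C_blowup M n S" by (simp add: G'_def M_def)
  have M: "M > 0" "m dvd M" "m > 0" using m by (auto simp: M_def)
  obtain vs where vs: "distinct vs" "length vs = l" "C = cycle_graph vs" and l3: "l \<ge> 3"
    using C by (auto simp: is_cycle_def)
  have l0: "l > 0" using l3 by simp
  have L3: "L \<ge> 3" unfolding L_def using l3 by (simp add: le_trans)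
  have L0: "L > 0" using L3 by simp
  have VC: "verts C = set vs" by (simp add: vs cycle_graph_def)
  have EC: "edges C = {{vs ! k, vs ! (Suc k mod l)} |k. k < l}"
    by (simp add: vs(2,3) cycle_graph_def)
  have vert: "vs ! (j mod l) \<in> verts (C_blowup m n S)" for j
    using CV VC vs(2) l0 by auto
  have edgeC: "{vs ! (j mod l), vs ! (Suc j mod l)} \<in> edges C" for j
    using l0 unfolding EC by (auto simp: mod_Suc_eq intro!: exI[of _ "j mod l"])
  have edge: "{vs ! (j mod l), vs ! (Suc j mod l)} \<in> edges (C_blowup m n S)" for j
    using edgeC CE by blast
  \<comment> \<open>The signs along the cycle, and the first coordinate of a walk that unwinds it in the integers.\<close>
  have "\<forall>j. \<exists>s. step n S s (snd (vs ! (j mod l))) (snd (vs ! (Suc j mod l))) \<and>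
      int (fst (vs ! (Suc j mod l))) = (int (fst (vs ! (j mod l))) + s) mod int m"
    using edge edge_C_blowup_iff_step[OF vert vert] by blast
  then obtain s where
    st: "\<And>j. step n S (s j) (snd (vs ! (j mod l))) (snd (vs ! (Suc j mod l)))" and
    sm: "\<And>j. int (fst (vs ! (Suc j mod l))) = (int (fst (vs ! (j mod l))) + s j) mod int m"
    by metis
  define h where "h j = int (fst (vs ! 0)) + (\<Sum>k<j. s (k mod l))" for j
  define D where "D = (\<Sum>k<l. s k)"
  have h_Suc: "h (Suc j) = h j + s (j mod l)" for j by (simp add: h_def)
  have h_shift: "h (j + q * l) = h j + int q * D" for j q
    unfolding h_def D_def sum_periodic_shift by simp
  have h_mod: "h j mod int m = int (fst (vs ! (j mod l)))" for j
  proof (induction j)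
    case 0
    have "fst (vs ! (0 mod l)) < m" using vert[of 0] by (auto simp: verts_C_blowup)
    then show ?case by (simp add: h_def)
  next
    case (Suc j)
    have "h (Suc j) mod int m = (int (fst (vs ! (j mod l))) + s (j mod l)) mod int m"
      unfolding h_Suc by (metis Suc.IH mod_add_left_eq)
    also have "\<dots> = int (fst (vs ! (Suc j mod l)))"
      using sm[of "j mod l"] by (simp add: mod_Suc_eq)
    finally show ?case .
  qed
  have "odd D" unfolding D_def
  proof (rule odd_sum_of_oddly_many_odds[OF l])
    show "odd (s k)" for k using st[of k] by (auto simp: step_def)
  qed
  have "int m dvd D"
  proof -
    have "h (0 + 1 * l) mod int m = h 0 mod int m" unfolding h_mod by simp
    then show ?thesis unfolding h_shift by (simp add: mod_eq_dvd_iff)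
  qed
  then obtain W where W: "D = int m * W" by blast
  then have "odd W" using \<open>odd D\<close> by simp
  then have copW: "coprime W (2 ^ t)" by simp
  \<comment> \<open>The lift of the walk to the covering graph.\<close>
  define w where "w j = (nat (h j mod int M), snd (vs ! (j mod l)))" for j
  have fst_w: "int (fst (w j)) = h j mod int M" for j using M by (simp add: w_def)
  have snd_w: "snd (w j) = snd (vs ! (j mod l))" for j by (simp add: w_def)
  have w_vert: "w j \<in> verts G'" for j
    using vert[of j] M fst_w[of j] snd_w[of j] unfolding G' verts_C_blowup
    by (auto simp: w_def nat_less_iff)
  have w_proj: "proj m (w j) = vs ! (j mod l)" for j
  proof -
    have "int (fst (w j) mod m) = h j mod int m"
      using M by (simp add: fst_w of_nat_mod mod_mod_cancel)
    then show ?thesis unfolding h_mod by (simp add: proj_def snd_w prod_eq_iff)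
  qed
  have w_edge: "{w j, w (Suc j)} \<in> edges G'" for j
    unfolding G'
  proof (subst edge_C_blowup_iff_step)
    have "step n S (s (j mod l)) (snd (w j)) (snd (w (Suc j)))"
      using st[of "j mod l"] by (simp add: snd_w mod_Suc_eq)
    moreover have "int (fst (w (Suc j))) = (int (fst (w j)) + s (j mod l)) mod int M"
      unfolding fst_w h_Suc by (simp add: mod_add_left_eq)
    ultimately show "\<exists>s. step n S s (snd (w j)) (snd (w (Suc j))) \<and>
        int (fst (w (Suc j))) = (int (fst (w j)) + s) mod int M" by blast
  qed (use w_vert G' in auto)
  have w_shift: "w (j + q * l) = w j \<longleftrightarrow> 2 ^ t dvd q" for j q
  proof -
    have "w (j + q * l) = w j \<longleftrightarrow> int (fst (w (j + q * l))) = int (fst (w j))"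
      by (simp add: prod_eq_iff snd_w)
    also have "\<dots> \<longleftrightarrow> int M dvd int q * D"
      unfolding fst_w h_shift by (simp add: mod_eq_dvd_iff)
    also have "\<dots> \<longleftrightarrow> 2 ^ t dvd int q * W"
      unfolding W M_def using m by (simp add: mult.left_commute)
    also have "\<dots> \<longleftrightarrow> 2 ^ t dvd int q"
      using copW by (simp add: coprime_commute coprime_dvd_mult_left_iff)
    also have "\<dots> \<longleftrightarrow> 2 ^ t dvd q"
      by (metis of_nat_dvd_iff of_nat_numeral of_nat_power)
    finally show ?thesis .
  qed
  have w_mod: "w (j mod L) = w j" for j
  proof -
    have "j = j mod L + (j div L * 2 ^ t) * l"
      unfolding L_def by (metis mod_div_mult_eq mult.assoc)
    then show ?thesis using w_shift[of "j mod L" "j div L * 2 ^ t"] by simp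
  qed
  have inj_le: "j = k" if "j \<le> k" "k < L" "w j = w k" for j k
  proof -
    have "vs ! (j mod l) = vs ! (k mod l)" using w_proj that(3) by metis
    then have "j mod l = k mod l" using vs l0 by (simp add: nth_eq_iff_index_eq)
    then have "l dvd k - j" using mod_eq_dvd_iff_nat[OF that(1), of l] by simp
    then obtain q where "k - j = l * q" by (rule dvdE)
    then have q: "k = j + q * l" using that(1) by (simp add: mult.commute)
    then have "2 ^ t dvd q" using w_shift[of j q] that(3) unfolding q by metis
    then obtain c where "q = 2 ^ t * c" by blast
    then have k: "k = j + L * c" using q by (simp add: L_def mult_ac)
    then have "L * c < L" using that(2) by linarith
    then have "c = 0" by simp
    then show ?thesis using k by simp
  qed
  have w_inj: "inj_on w {0..<L}"
  proof (rule inj_onI)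
    fix j k assume "j \<in> {0..<L}" "k \<in> {0..<L}" "w j = w k"
    then show "j = k" using inj_le[of j k] inj_le[of k j] by (cases "j \<le> k") auto
  qed
  \<comment> \<open>The odd winding number is invertible modulo \<open>2\<^sup>t\<close>, so some number of turns leads from one
    vertex of a fibre to any other.\<close>
  have w_surj: "\<exists>j. u = w j \<and> j mod l = k" if u: "u \<in> verts G'" "proj m u = vs ! k" "k < l" for u k
  proof -
    have uM: "fst u < M" using u by (auto simp: G' verts_C_blowup)
    have "int (fst u) mod int m = h k mod int m"
      using u(2,3) unfolding h_mod by (metis fst_conv mod_less of_nat_mod proj_def)
    then have "int m dvd int (fst u) - h k" by (simp add: mod_eq_dvd_iff)
    then obtain c where c: "int (fst u) - h k = int m * c" by blast
    obtain x where x: "[W * x = c] (mod 2 ^ t)"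
      using cong_solve_coprime_int[OF copW] cong_scalar_right[of _ 1 "2 ^ t" c]
      by (metis mult.assoc mult_1)
    define q where "q = nat (x mod 2 ^ t)"
    have q: "int q = x mod 2 ^ t" by (simp add: q_def)
    have "[W * int q = c] (mod 2 ^ t)"
      using x unfolding q cong_def by (simp add: mod_mult_right_eq)
    then have "2 ^ t dvd c - W * int q"
      by (metis cong_iff_dvd_diff cong_sym)
    then have "int M dvd int m * (c - W * int q)"
      unfolding M_def by (simp add: mult.commute)
    also have "int m * (c - W * int q) = int (fst u) - h (k + q * l)"
      unfolding h_shift W using c by (simp add: algebra_simps)
    finally have "int (fst u) mod int M = h (k + q * l) mod int M" by (simp add: mod_eq_dvd_iff)
    then have "fst u = fst (w (k + q * l))" using uM fst_w[of "k + q * l"] by simp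
    moreover have "snd u = snd (w (k + q * l))"
      using u by (simp add: snd_w proj_def prod_eq_iff)
    ultimately have "u = w (k + q * l)" by (simp add: prod_eq_iff)
    then show ?thesis using u(3) by (intro exI[of _ "k + q * l"]) simp
  qed
  have edge_w: "\<exists>j. {u, v} = {w j, w (Suc j)}"
    if uv: "u \<in> verts G'" "v \<in> verts G'" "{u, v} \<in> edges G'"
      and k: "k < l" "proj m u = vs ! k" "proj m v = vs ! (Suc k mod l)" for u v k
  proof -
    obtain j where j: "u = w j" "j mod l = k" using w_surj uv(1) k by blast
    have "v = w (Suc j)"
    proof (rule unique_edge_lift[OF m M(2)])
      show "proj m v = proj m (w (Suc j))"
        unfolding w_proj k(3) j(2)[symmetric] by (simp add: mod_Suc_eq)
    qed (use uv w_vert w_edge j G' in auto)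
    then show ?thesis using j by blast
  qed
  define ws where "ws = map w [0..<L]"
  have len: "length ws = L" by (simp add: ws_def)
  have set_ws: "set ws = {u \<in> verts G'. proj m u \<in> verts C}"
  proof (intro equalityI subsetI)
    fix u assume "u \<in> set ws"
    then obtain j where "u = w j" by (auto simp: ws_def)
    then show "u \<in> {u \<in> verts G'. proj m u \<in> verts C}"
      using w_vert w_proj VC vs(2) l0 by auto
  next
    fix u assume "u \<in> {u \<in> verts G'. proj m u \<in> verts C}"
    then obtain k where "u \<in> verts G'" "k < l" "proj m u = vs ! k"
      using VC vs(2) by (auto simp: in_set_conv_nth)
    then obtain j where "u = w j" using w_surj by blast
    then have "u = w (j mod L)" by (simp add: w_mod)
    then show "u \<in> set ws" using L0 by (auto simp: ws_def)
  qed
  have "edges (cycle_graph ws) = {{w j, w (Suc j mod L)} |j. j < L}"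
  proof -
    have "ws ! j = w j" if "j < L" for j using that by (simp add: ws_def)
    then show ?thesis
      using L0 unfolding cycle_graph_def graph.sel len by (metis (lifting) mod_less_divisor)
  qed
  also have "\<dots> = {{w j, w (Suc j)} |j. True}"
  proof (intro equalityI subsetI)
    fix e assume "e \<in> {{w j, w (Suc j)} |j. True}"
    then obtain j where "e = {w j, w (Suc j)}" by blast
    also have "\<dots> = {w (j mod L), w (Suc (j mod L) mod L)}"
      using w_mod by (metis mod_Suc_eq)
    finally show "e \<in> {{w j, w (Suc j mod L)} |j. j < L}"
      using L0 by (auto intro!: exI[of _ "j mod L"])
  qed (auto simp: w_mod)
  also have "\<dots> = lift_edges m G' (edges C)"
  proof (intro equalityI subsetI)
    fix e assume "e \<in> {{w j, w (Suc j)} |j. True}"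
    then show "e \<in> lift_edges m G' (edges C)"
      using w_edge edgeC by (auto simp: lift_edges_def w_proj)
  next
    fix e assume "e \<in> lift_edges m G' (edges C)"
    then have e: "e \<in> edges G'" "proj m ` e \<in> edges C" by (auto simp: lift_edges_def)
    obtain u v where uv: "e = {u, v}" "u \<in> verts G'" "v \<in> verts G'"
      using e(1) edge_C_blowup_cases unfolding G' by metis
    obtain k where k: "k < l" "{proj m u, proj m v} = {vs ! k, vs ! (Suc k mod l)}"
      using e(2) uv(1) unfolding EC by auto
    then consider "proj m u = vs ! k" "proj m v = vs ! (Suc k mod l)"
      | "proj m v = vs ! k" "proj m u = vs ! (Suc k mod l)"
      by (auto simp: doubleton_eq_iff)
    then have "\<exists>j. e = {w j, w (Suc j)}"
      using edge_w[OF uv(2,3) _ k(1)] edge_w[OF uv(3,2) _ k(1)] e(1) uv(1)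
      by cases (auto simp: insert_commute)
    then show "e \<in> {{w j, w (Suc j)} |j. True}" by blast
  qed
  finally have "lift_graph m G' C = cycle_graph ws"
    using set_ws by (simp add: lift_graph_def cycle_graph_def)
  moreover have "distinct ws" using w_inj by (simp add: ws_def distinct_map)
  ultimately show ?thesis
    unfolding is_cycle_def using len L3 by (auto simp: L_def)
qed

section \<open>Lifting factors and solutions\<close>

lemma cycle_factor_lift_graph:
  fixes l m n t :: nat and S :: "nat set"
  defines "G' \<equiv> C_blowup (2 ^ t * m) n S"
  assumes l: "odd l" and m: "m \<ge> 3" and n: "n \<ge> 1"
    and H: "cycle_factor l (C_blowup m n S) H"
  shows "cycle_factor (2 ^ t * l) G' (lift_graph m G' H)"
proof -
  obtain \<C> where \<C>: "\<forall>C\<in>\<C>. is_cycle l C" "disjoint_family_on verts \<C>"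
      "H = Graph (\<Union>C\<in>\<C>. verts C) (\<Union>C\<in>\<C>. edges C)"
    using H by (auto simp: cycle_factor_def)
  have sp: "verts H = verts (C_blowup m n S)" "edges H \<subseteq> edges (C_blowup m n S)"
    using H by (auto simp: cycle_factor_def spanning_subgraph_def)
  have "2 ^ t * m \<ge> 3" using m by (simp add: le_trans)
  then have simple: "simple_graph G'" unfolding G'_def using n by (rule simple_graph_C_blowup)
  have V: "verts (lift_graph m G' H) = verts G'"
    using proj_verts[of m _ "2 ^ t * m" n S] m by (auto simp: lift_graph_def sp G'_def)
  have E: "edges (lift_graph m G' H) \<subseteq> edges G'" by (auto simp: lift_graph_def lift_edges_def)
  have span: "spanning_subgraph (lift_graph m G' H) G'"
    using simple V E unfolding spanning_subgraph_def simple_graph_def by auto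
  have cyc: "is_cycle (2 ^ t * l) (lift_graph m G' C)" if "C \<in> \<C>" for C
    unfolding G'_def
  proof (rule is_cycle_lift_graph[OF l m])
    show "verts C \<subseteq> verts (C_blowup m n S)" using sp(1) \<C>(3) that by auto
    show "edges C \<subseteq> edges (C_blowup m n S)" using sp(2) \<C>(3) that by auto
  qed (use \<C>(1) that in blast)
  have disj: "disjoint_family_on verts (lift_graph m G' ` \<C>)"
    using \<C>(2) unfolding disjoint_family_on_def lift_graph_def by fastforce
  have "lift_graph m G' H = Graph (\<Union>C\<in>lift_graph m G' ` \<C>. verts C) (\<Union>C\<in>lift_graph m G' ` \<C>. edges C)"
    unfolding \<C>(3) by (auto simp: lift_graph_def lift_edges_def)
  then show ?thesis
    unfolding cycle_factor_def using span cyc disj by blast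
qed

text \<open>
  A set of edges can be recovered from its preimage.  Therefore taking preimages is injective and
  preserves non-emptiness, as needed to lift a partition with the same number of parts.
\<close>

lemma image_lift_edges:
  assumes "M > 0" "m dvd M" "F \<subseteq> edges (C_blowup m n S)"
  shows "(`) (proj m) ` lift_edges m (C_blowup M n S) F = F"
proof (intro equalityI subsetI)
  fix e assume "e \<in> F"
  then obtain e' where "e' \<in> edges (C_blowup M n S)" "proj m ` e' = e"
    using edge_has_lift[OF assms(1,2)] assms(3) by blast
  then show "e \<in> (`) (proj m) ` lift_edges m (C_blowup M n S) F"
    using \<open>e \<in> F\<close> by (auto simp: lift_edges_def)
qed (auto simp: lift_edges_def)

lemma partition_on_lift_edges:
  assumes "M > 0" "m > 0" "m dvd M" and P: "partition_on (edges (C_blowup m n S)) P"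
  shows "partition_on (edges (C_blowup M n S)) (lift_edges m (C_blowup M n S) ` P)"
proof (rule partition_onI)
  show "\<Union> (lift_edges m (C_blowup M n S) ` P) = edges (C_blowup M n S)"
    using proj_edge[OF assms(2,3)] partition_onD1[OF P] by (fastforce simp: lift_edges_def)
  show "disjnt p q" if "p \<in> lift_edges m (C_blowup M n S) ` P"
      "q \<in> lift_edges m (C_blowup M n S) ` P" "p \<noteq> q" for p q
    using that partition_onD2[OF P] unfolding disjnt_def lift_edges_def disjoint_def by fastforce
  show "{} \<notin> lift_edges m (C_blowup M n S) ` P"
  proof
    assume "{} \<in> lift_edges m (C_blowup M n S) ` P"
    then obtain F where F: "F \<in> P" "lift_edges m (C_blowup M n S) F = {}" by auto
    have "F \<subseteq> edges (C_blowup m n S)" using F(1) partition_onD1[OF P] by auto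
    then have "F = {}" using image_lift_edges[OF assms(1,3), of F n S] F(2) by simp
    then show False using F(1) partition_onD3[OF P] by simp
  qed
qed

theorem theorem2p5:
  fixes l1 l2 m n t \<alpha> \<beta> :: nat and S :: "nat set"
  assumes "l1 \<ge> 3" and "odd l1"
    and "l2 \<ge> 3" and "odd l2"
    and "m \<ge> 3" and "odd m"
    and "n \<ge> 1" and "t \<ge> 1"
    and "S \<subseteq> {0..<n}"
    and "HWP (C_blowup m n S) l1 l2 \<alpha> \<beta>"
  shows "HWP (C_blowup (2 ^ t * m) n S) (2 ^ t * l1) (2 ^ t * l2) \<alpha> \<beta>"
proof -
  define G' where "G' = C_blowup (2 ^ t * m) n S"
  have M: "2 ^ t * m > 0" "m > 0" "m dvd 2 ^ t * m" using assms(5) by auto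
  obtain P Q where sol: "HWP_solution (C_blowup m n S) l1 l2 \<alpha> \<beta> P Q"
    using assms(10) by (auto simp: HWP_def)
  then have part: "partition_on (edges (C_blowup m n S)) (P \<union> Q)" and dis: "P \<inter> Q = {}"
    by (auto simp: HWP_solution_def)
  let ?lift = "lift_edges m G'"
  \<comment> \<open>Distinct factors have distinct preimages, as each factor is the image of its preimage.\<close>
  have inj: "inj_on ?lift (P \<union> Q)"
  proof (rule inj_on_inverseI)
    show "(`) (proj m) ` ?lift F = F" if "F \<in> P \<union> Q" for F
      unfolding G'_def using M partition_onD1[OF part] that by (intro image_lift_edges) auto
  qed
  have lift: "\<exists>H'. cycle_factor (2 ^ t * l) G' H' \<and> ?lift F = edges H'"
    if "odd l" "\<exists>H. cycle_factor l (C_blowup m n S) H \<and> F = edges H" for l F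
    using that cycle_factor_lift_graph[OF that(1) assms(5,7)] unfolding G'_def
    by (metis graph.sel(2) lift_graph_def)
  have "HWP_solution G' (2 ^ t * l1) (2 ^ t * l2) \<alpha> \<beta> (?lift ` P) (?lift ` Q)"
    unfolding HWP_solution_def
  proof (intro conjI)
    show "card (?lift ` P) = \<alpha>" "card (?lift ` Q) = \<beta>"
      using sol inj by (auto simp: HWP_solution_def card_image inj_on_Un)
    show "?lift ` P \<inter> ?lift ` Q = {}"
      using inj_on_image_Int[OF inj, of P Q] dis by simp
    show "partition_on (edges G') (?lift ` P \<union> ?lift ` Q)"
      using partition_on_lift_edges[OF M part] unfolding G'_def image_Un .
  qed (use sol lift assms(2,4) in \<open>auto simp: HWP_solution_def\<close>)
  then show ?thesis unfolding HWP_def G'_def by blast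
qed

end
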